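(* Consider the Bayesian persuasion game with $k=1$ selection and $N$ symmetric agents, where the priors $\mathcal F_i$ are i.i.d. $\mathrm{Bernoulli}(\zeta)$ with $N\zeta\le 1$, and every agent $i\in[N]$ has constant utility of selection (that is, $u_i(0)=u_i(1)=1$ when selected). Then the price of anarchy satisfies $$\mathrm{PoA}(\mathcal I)\ \ge\ \Bigl(2-\frac1N\Bigr)\Bigl(\frac{1-e^{-N\zeta}}{N\zeta}\Bigr)\ \in\ \Bigl[1.264,\ 2-O\Bigl(\frac1N\Bigr)\Bigr].$$
   Context: Model. There are $N$ agents and a principal who selects $k$ agents (here $k=1$). An instance $\mathcal I=((\mathcal F_1,\dots,\mathcal F_N),(u_1,\dots,u_N))$ consists of prior value distributions and utility functions. Agent $i$ has a value $v_i\sim\mathcal F_i$, where $\mathcal F_i$ is a probability distribution on $[0,1]$; values are independent across agents. Agent $i$'s strategy is a signaling scheme $\mathcal Z_i=(\Sigma_i,\pi_i)$, where $\Sigma_i$ is a measurable space of signals and $\pi_i$ is a probability kernel from $[0,1]$ to $\Sigma_i$: given $v_i$, the signal $\sigma_i$ is drawn from $\pi_i(\cdot\mid v_i)$, independently across agents. The agent commits to the scheme before her value is realized, and priors and schemes are common knowledge. Let $\boldsymbol\Pi$ be the law of $\boldsymbol\sigma=(\sigma_1,\dots,\sigma_N)$, let $e_i(\sigma_i)=\mathbb E[v_i\mid\sigma_i]$ be the posterior mean, and $e_{(1)}(\boldsymbol\sigma)\ge\cdots\ge e_{(N)}(\boldsymbol\sigma)$ the sorted posterior means. The principal selects the $k$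 agents with the highest posterior means, breaking ties uniformly at random; $\rho_i(\boldsymbol\sigma)$ is the resulting probability that agent $i$ is selected. An agent selected with value $v$ gets utility $u_i(v)$, and otherwise $0$. For a strategy profile $\mathcal Z=(\mathcal Z_1,\dots,\mathcal Z_N)$: $u_i(\mathcal Z)=\mathbb E_{\boldsymbol\sigma\sim\boldsymbol\Pi}[\rho_i(\boldsymbol\sigma)\,\mathbb E[u_i(v_i)\mid\sigma_i]]$ and $\mathrm{SW}(\mathcal Z)=\mathbb E_{\boldsymbol\sigma\sim\boldsymbol\Pi}[\sum_{j=1}^k e_{(j)}(\boldsymbol\sigma)]$. $\mathcal Z$ is a Nash equilibrium if for every agent $i$ and every signaling scheme $\mathcal Z_i'$, $u_i(\mathcal Z)\ge u_i(\mathcal Z_i',\mathcal Z_{-i})$, where $(\mathcal Z_i',\mathcal Z_{-i})$ is $\mathcal Z$ with $\mathcal Z_i$ replaced by $\mathcal Z_i'$. The first-best welfare is $\mathrm{SW}^{\max}(\mathcal I)=\mathbb E[\max_{S\subseteq[N],|S|=k}\sum_{i\in S}v_i]$, and, for an instance $\mathcal I$ that has a Nash equilibrium, $\mathrm{PoA}(\mathcal I)=\mathrm{SW}^{\max}(\mathcal I)/\inf_{\mathcal Z}\mathrm{SW}(\mathcal Z)$, the infimum over all Nash equilibria $\mathcal Z$ of $\mathcal I$.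
   Formalization: The bound can fall below 1.264 for small N (N=2, ζ=1/2 gives 0.948), so the range is proved as [1.264−1/N, 2−1/N] for all N and [1.264, 2−1/N] for large N; ζ>0 is assumed; signals lie in any one set of at least continuum size, no loss on replacing signals by posterior means. *)

theory Defs
  imports "HOL-Probability.Probability"
begin

text \<open>
  Bayesian persuasion with one selected agent. The agents are the numbers below \<open>N\<close>;
  \<open>F i\<close> is the prior of agent \<open>i\<close> and \<open>u i\<close> her utility of being selected.
\<close>

abbreviation unit_interval :: "real measure" where
  "unit_interval \<equiv> restrict_space borel {0..1}"

definition bernoulli_prior :: "real \<Rightarrow> real measure" where
  "bernoulli_prior \<zeta> = distr (measure_pmf (bernoulli_pmf \<zeta>)) unit_interval of_bool"

text \<open>
  A signaling scheme \<open>(S, \<pi>)\<close> consists of a measurable space \<open>S\<close> (only the carrier and the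
  sigma-algebra of the measure \<open>S\<close> matter) and a probability kernel \<open>\<pi>\<close> from \<open>[0,1]\<close> to \<open>S\<close>.
  HOL cannot quantify over the carrier types of all measurable spaces, so the signals of all
  agents are elements of one type \<open>'s\<close>; the carrier and the sigma-algebra within \<open>'s\<close> are
  arbitrary and may differ between agents.
\<close>

type_synonym 's scheme = "'s measure \<times> (real \<Rightarrow> 's measure)"

definition is_scheme :: "'s scheme \<Rightarrow> bool" where
  "is_scheme Z \<longleftrightarrow> snd Z \<in> unit_interval \<rightarrow>\<^sub>M prob_algebra (fst Z)"

text \<open>The joint law of the pair (value, signal) of a single agent with prior \<open>D\<close>.\<close>

definition joint_law :: "real measure \<Rightarrow> 's scheme \<Rightarrow> (real \<times> 's) measure" where
  "joint_law D Z = D \<bind> (\<lambda>v. distr (snd Z v) (D \<Otimes>\<^sub>M fst Z) (Pair v))"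

text \<open>
  \<open>cond_signal D Z f\<close> is the conditional expectation of \<open>f v\<close> given the signal. As usual for
  the library's conditional expectation it is a function on the underlying sample space, here
  the space of pairs (value, signal), that is measurable with respect to the signal.
\<close>

definition cond_signal :: "real measure \<Rightarrow> 's scheme \<Rightarrow> (real \<Rightarrow> real) \<Rightarrow> real \<times> 's \<Rightarrow> real" where
  "cond_signal D Z f =
     real_cond_exp (joint_law D Z)
       (vimage_algebra (space (joint_law D Z)) snd (fst Z)) (\<lambda>x. f (fst x))"

abbreviation posterior_mean :: "real measure \<Rightarrow> 's scheme \<Rightarrow> real \<times> 's \<Rightarrow> real" where
  "posterior_mean D Z \<equiv> cond_signal D Z (\<lambda>v. v)"

text \<open>
  An outcome assigns to each agent her pair (value, signal), independently across agents.
  Expectations over the signal vector are taken over outcomes; the integrands below depend on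
  an outcome only through the signals.
\<close>

definition outcome_law ::
    "nat \<Rightarrow> (nat \<Rightarrow> real measure) \<Rightarrow> (nat \<Rightarrow> 's scheme) \<Rightarrow> (nat \<Rightarrow> real \<times> 's) measure" where
  "outcome_law N F Z = PiM {..<N} (\<lambda>i. joint_law (F i) (Z i))"

text \<open>
  Probability that agent \<open>i\<close> is selected when the posterior means are \<open>e\<close>: the agent with the
  highest posterior mean is selected, ties being broken uniformly at random.
\<close>

definition selection_prob :: "nat \<Rightarrow> (nat \<Rightarrow> real) \<Rightarrow> nat \<Rightarrow> real" where
  "selection_prob N e i =
     (let T = {j. j < N \<and> (\<forall>l<N. e l \<le> e j)} in if i \<in> T then 1 / real (card T) else 0)"

definition payoff ::
    "nat \<Rightarrow> (nat \<Rightarrow> real measure) \<Rightarrow> (nat \<Rightarrow> real \<Rightarrow> real) \<Rightarrow> (nat \<Rightarrow> 's scheme) \<Rightarrow> nat \<Rightarrow> real" where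
  "payoff N F u Z i =
     (\<integral>\<omega>. selection_prob N (\<lambda>j. posterior_mean (F j) (Z j) (\<omega> j)) i
           * cond_signal (F i) (Z i) (u i) (\<omega> i) \<partial>outcome_law N F Z)"

definition welfare ::
    "nat \<Rightarrow> (nat \<Rightarrow> real measure) \<Rightarrow> (nat \<Rightarrow> 's scheme) \<Rightarrow> real" where
  "welfare N F Z =
     (\<integral>\<omega>. Max ((\<lambda>j. posterior_mean (F j) (Z j) (\<omega> j)) ` {..<N}) \<partial>outcome_law N F Z)"

definition nash_equilibrium ::
    "nat \<Rightarrow> (nat \<Rightarrow> real measure) \<Rightarrow> (nat \<Rightarrow> real \<Rightarrow> real) \<Rightarrow> (nat \<Rightarrow> 's scheme) \<Rightarrow> bool" where
  "nash_equilibrium N F u Z \<longleftrightarrow>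
     (\<forall>i<N. is_scheme (Z i)) \<and>
     (\<forall>i<N. \<forall>Z'. is_scheme Z' \<longrightarrow> payoff N F u Z i \<ge> payoff N F u (Z(i := Z')) i)"

definition first_best :: "nat \<Rightarrow> (nat \<Rightarrow> real measure) \<Rightarrow> real" where
  "first_best N F = (\<integral>v. Max (v ` {..<N}) \<partial>PiM {..<N} F)"

text \<open>The type argument is the type of signals. Meaningful only if an equilibrium exists.\<close>

definition price_of_anarchy ::
    "'s itself \<Rightarrow> nat \<Rightarrow> (nat \<Rightarrow> real measure) \<Rightarrow> (nat \<Rightarrow> real \<Rightarrow> real) \<Rightarrow> real" where
  "price_of_anarchy _ N F u =
     first_best N F /
     Inf {welfare N F Z | Z :: nat \<Rightarrow> 's scheme. nash_equilibrium N F u Z}"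

definition poa_bound :: "nat \<Rightarrow> real \<Rightarrow> real" where
  "poa_bound N \<zeta> = (2 - 1 / real N) * ((1 - exp (- (real N * \<zeta>))) / (real N * \<zeta>))"

end

theory Submission
  imports Defs
begin

text \<open>
  Let the signal be a uniform \<open>t \<in> [0,1]\<close> with \<open>P(v = 1 | t) = N \<zeta> t^(N - 1)\<close>, so that the
  posterior mean is \<open>e = N \<zeta> t^(N - 1)\<close>. Against \<open>N - 1\<close> rivals using this scheme, an agent with
  posterior mean \<open>x\<close> wins with probability at most \<open>x / (N \<zeta>)\<close>. Since posterior means average to
  \<open>\<zeta>\<close>, no scheme earns more than \<open>1 / N\<close>; as the payoffs of a profile add up to \<open>1\<close>, everybody
  using the scheme is an equilibrium. The same bound on the winning probability shows that its
  welfare is at most \<open>N E[e\<^sup>2] / (N \<zeta>) = N \<zeta> / (2 - 1/N)\<close>, while the first best is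
  \<open>1 - (1 - \<zeta>)^N \<ge> 1 - exp (- N \<zeta>)\<close>. The welfare of any profile is at least \<open>\<zeta>\<close>, so
  the infimum in the price of anarchy is positive. For \<open>N = 1\<close> every profile is an equilibrium.
\<close>

section \<open>The Bernoulli prior as a measure on the unit interval\<close>

lemma measurable_ident_unit_interval [measurable]:
  "(\<lambda>v. v) \<in> borel_measurable unit_interval"
  by (rule measurable_restrict_space1) simp

lemma sets_bernoulli_prior [simp, measurable_cong]:
  "sets (bernoulli_prior \<zeta>) = sets unit_interval"
  by (simp add: bernoulli_prior_def)

lemma measurable_of_bool_unit_interval:
  "of_bool \<in> measurable (measure_pmf p) unit_interval"
  by (auto intro!: measurable_restrict_space2)

lemma prob_space_bernoulli_prior: "prob_space (bernoulli_prior \<zeta>)"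
  unfolding bernoulli_prior_def
  by (intro prob_space.prob_space_distr measure_pmf.prob_space_axioms
      measurable_of_bool_unit_interval)

lemma nn_integral_bernoulli_prior:
  assumes "0 \<le> \<zeta>" "\<zeta> \<le> 1" "f \<in> borel_measurable unit_interval"
  shows "(\<integral>\<^sup>+v. f v \<partial>bernoulli_prior \<zeta>) = ennreal \<zeta> * f 1 + ennreal (1 - \<zeta>) * f 0"
proof -
  have "(\<integral>\<^sup>+v. f v \<partial>bernoulli_prior \<zeta>)
      = (\<integral>\<^sup>+b. f (of_bool b) \<partial>measure_pmf (bernoulli_pmf \<zeta>))"
    unfolding bernoulli_prior_def
    by (rule nn_integral_distr[OF measurable_of_bool_unit_interval]) (use assms in simp)
  then show ?thesis
    using assms by (simp add: mult.commute)
qed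

lemma integral_bernoulli_prior:
  fixes f :: "real \<Rightarrow> real"
  assumes "0 \<le> \<zeta>" "\<zeta> \<le> 1" "f \<in> borel_measurable unit_interval"
  shows "(\<integral>v. f v \<partial>bernoulli_prior \<zeta>) = \<zeta> * f 1 + (1 - \<zeta>) * f 0"
proof -
  have "(\<integral>v. f v \<partial>bernoulli_prior \<zeta>)
      = (\<integral>b. f (of_bool b) \<partial>measure_pmf (bernoulli_pmf \<zeta>))"
    unfolding bernoulli_prior_def
    by (rule integral_distr[OF measurable_of_bool_unit_interval assms(3)])
  then show ?thesis
    using assms by (simp add: mult.commute)
qed

lemma AE_bernoulli_prior: "AE v in bernoulli_prior \<zeta>. v = 0 \<or> v = 1"
proof -
  have "{v \<in> space unit_interval. v = 0 \<or> v = 1} \<in> sets unit_interval"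
    by (intro sets.sets_Collect_disj borel_measurable_eq measurable_ident_unit_interval
        borel_measurable_const)
  then show ?thesis
    unfolding bernoulli_prior_def
    by (subst AE_distr_iff[OF measurable_of_bool_unit_interval]) auto
qed

section \<open>First-best welfare\<close>

lemma one_minus_power_le_exp:
  assumes "\<zeta> \<le> 1"
  shows "(1 - \<zeta>) ^ N \<le> exp (- (real N * \<zeta>))"
proof -
  have "(1 - \<zeta>) ^ N \<le> exp (- \<zeta>) ^ N"
    using assms exp_ge_add_one_self[of "- \<zeta>"] by (intro power_mono) auto
  then show ?thesis
    by (simp add: exp_of_nat_mult[symmetric])
qed

text \<open>On values in {0, 1} the maximum is one minus the product of the \<open>1 - v i\<close>.
  By independence the product has expectation \<open>(1 - \<zeta>) ^ N\<close>, so the first best is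
  exactly \<open>1 - (1 - \<zeta>) ^ N\<close>.\<close>

lemma first_best_bernoulli_ge:
  assumes "N \<ge> 1" "0 \<le> \<zeta>" "\<zeta> \<le> 1"
  shows "first_best N (\<lambda>_. bernoulli_prior \<zeta>) \<ge> 1 - exp (- (real N * \<zeta>))"
proof -
  let ?D = "\<lambda>_::nat. bernoulli_prior \<zeta>"
  let ?P = "PiM {..<N} ?D"
  interpret D: prob_space "bernoulli_prior \<zeta>" by (rule prob_space_bernoulli_prior)
  interpret P: product_prob_space ?D "{..<N}" by unfold_locales
  have [measurable]: "(\<lambda>v. v) \<in> borel_measurable (bernoulli_prior \<zeta>)"
    by measurable
  have int: "integrable (bernoulli_prior \<zeta>) (\<lambda>v. 1 - v)"
  proof (rule D.integrable_const_bound[where B=1])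
    show "AE v in bernoulli_prior \<zeta>. norm (1 - v) \<le> 1"
      using AE_bernoulli_prior by eventually_elim auto
  qed measurable
  have "(\<integral>v. (\<Prod>i<N. 1 - v i) \<partial>?P) = (\<Prod>i<N. \<integral>v. 1 - v \<partial>bernoulli_prior \<zeta>)"
    by (rule P.product_integral_prod) (use int in auto)
  also have "(\<integral>v. 1 - v \<partial>bernoulli_prior \<zeta>) = 1 - \<zeta>"
    using assms by (subst integral_bernoulli_prior) (auto simp: measurable_restrict_space1)
  finally have prod: "(\<integral>v. (\<Prod>i<N. 1 - v i) \<partial>?P) = (1 - \<zeta>) ^ N" by simp
  have intp: "integrable ?P (\<lambda>v. \<Prod>i<N. 1 - v i)"
    by (rule P.product_integrable_prod) (use int in auto)
  have "AE v in ?P. \<forall>i\<in>{..<N}. v i = 0 \<or> v i = 1"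
    by (subst AE_finite_all)
      (auto intro!: AE_PiM_component[of "{..<N}" ?D] prob_space_bernoulli_prior AE_bernoulli_prior)
  then have ae: "AE v in ?P. Max (v ` {..<N}) = 1 - (\<Prod>i<N. 1 - v i)"
  proof (rule AE_mp, intro AE_I2 impI)
    fix v :: "nat \<Rightarrow> real" assume v: "\<forall>i\<in>{..<N}. v i = 0 \<or> v i = 1"
    show "Max (v ` {..<N}) = 1 - (\<Prod>i<N. 1 - v i)"
    proof (cases "\<exists>i<N. v i = 1")
      case True
      then have "(\<Prod>i<N. 1 - v i) = 0" by (intro prod_zero) auto
      moreover have "Max (v ` {..<N}) = 1"
        using v True by (intro Max_eqI) force+
      ultimately show ?thesis by simp
    next
      case False
      then have "\<forall>i<N. v i = 0" using v by auto
      moreover have "Max (v ` {..<N}) = 0"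
      proof (rule Max_eqI)
        show "0 \<in> v ` {..<N}"
          using assms(1) \<open>\<forall>i<N. v i = 0\<close> by (intro image_eqI[of _ _ 0]) auto
      qed (use \<open>\<forall>i<N. v i = 0\<close> in auto)
      ultimately show ?thesis by simp
    qed
  qed
  have "first_best N ?D = (\<integral>v. 1 - (\<Prod>i<N. 1 - v i) \<partial>?P)"
    unfolding first_best_def
    by (rule integral_cong_AE[OF _ _ ae]) measurable
  also have "\<dots> = 1 - (1 - \<zeta>) ^ N"
    using intp prod P.P.prob_space by simp
  finally show ?thesis
    using one_minus_power_le_exp[OF assms(3), of N] by simp
qed

section \<open>Numerical estimates for the bound\<close>

lemma one_minus_exp_ge_mult:
  fixes x :: real
  assumes "0 \<le> x" "x \<le> 1"
  shows "(1 - exp (- 1)) * x \<le> 1 - exp (- x)"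
proof -
  \<comment> \<open>Convexity of \<open>exp\<close>: \<open>- x\<close> is the combination of 0 and
    -1 with weights \<open>1 - x\<close> and \<open>x\<close>, and the graph lies below the chord
    between these points.\<close>
  have "exp ((1 - x) *\<^sub>R 0 + x *\<^sub>R (- 1)) \<le> (1 - x) * exp 0 + x * exp (- 1 :: real)"
    by (rule convex_onD[OF exp_convex]) (use assms in auto)
  then show ?thesis by (simp add: algebra_simps)
qed

lemma exp_minus_one_le: "exp (- 1 :: real) \<le> 0.36788"
proof -
  have "exp 1 \<ge> (2.7182818 :: real)"
    using e_approx_32 by (simp add: abs_if split: if_splits)
  then have "inverse (exp 1) \<le> inverse (2.7182818 :: real)"
    by (intro le_imp_inverse_le) auto
  then show ?thesis
    by (simp add: exp_minus)
qed

lemma poa_bound_le: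
  assumes "N \<ge> 1" "0 < \<zeta>"
  shows "poa_bound N \<zeta> \<le> 2 - 1 / real N"
proof -
  have "(1 - exp (- (real N * \<zeta>))) / (real N * \<zeta>) \<le> 1"
    using assms exp_ge_add_one_self[of "- (real N * \<zeta>)"] by simp
  moreover have "1 / real N \<le> 1" using assms by simp
  ultimately show ?thesis
    unfolding poa_bound_def by (intro mult_left_le) auto
qed

text \<open>On (0, 1] the chord estimate bounds \<open>(1 - exp (- x)) / x\<close> below by its
  value \<open>1 - exp (- 1)\<close> at \<open>x = 1\<close>. The constant 0.63212 = 1 - 0.36788
  lies just under that value.\<close>

lemma poa_bound_ge:
  assumes "N \<ge> 1" "0 < \<zeta>" "real N * \<zeta> \<le> 1"
  shows "poa_bound N \<zeta> \<ge> (2 - 1 / real N) * 0.63212"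
proof -
  have "0.63212 * (real N * \<zeta>) \<le> (1 - exp (- 1)) * (real N * \<zeta>)"
    using exp_minus_one_le assms by (intro mult_right_mono) auto
  also have "\<dots> \<le> 1 - exp (- (real N * \<zeta>))"
    using assms by (intro one_minus_exp_ge_mult) auto
  finally have "0.63212 \<le> (1 - exp (- (real N * \<zeta>))) / (real N * \<zeta>)"
    using assms by (simp add: pos_le_divide_eq)
  moreover have "1 / real N \<le> 1" using assms by simp
  ultimately show ?thesis
    unfolding poa_bound_def by (intro mult_left_mono) auto
qed

text \<open>The constant 1.264 is 2 (1 - 1/e) = 1.26424... rounded down, so it is a valid lower end
  only for large \<open>n\<close>: for \<open>n = 1\<close> and \<open>z = 1\<close> the bound is 1
  - 1/e.\<close>

lemma eventually_poa_bound_in: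
  "\<forall>\<^sub>F n in sequentially. \<forall>z>0. real n * z \<le> 1 \<longrightarrow>
     poa_bound n z \<in> {1.264 .. 2 - 1 / real n}"
  \<comment> \<open>The slack 2 * 0.63212 - 1.264 = 0.00024 has to pay for 0.63212 / n, which holds
    from n = 2634 on; 10000 is a round number beyond that.\<close>
  using eventually_ge_at_top[of 10000]
proof eventually_elim
  case (elim n)
  have "1 / real n \<le> 1 / 10000"
    using elim by (intro divide_left_mono) auto
  then have "1.264 \<le> (2 - 1 / real n) * 0.63212" by simp
  then show ?case
    using poa_bound_le[of n] poa_bound_ge[of n] elim by force
qed

section \<open>A single agent: joint law of value and signal, and posterior mean\<close>

locale agent = prior: prob_space D for D :: "real measure" +
  fixes Z :: "'s scheme"
  assumes sets_prior [measurable_cong]: "sets D = sets unit_interval"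
    and scheme: "is_scheme Z"
begin

abbreviation "J \<equiv> joint_law D Z"
abbreviation "E \<equiv> posterior_mean D Z"

lemma space_prior: "space D = {0..1}"
  using sets_eq_imp_space_eq[OF sets_prior] by simp

lemma kernel_prob [measurable]: "snd Z \<in> D \<rightarrow>\<^sub>M prob_algebra (fst Z)"
  using scheme unfolding is_scheme_def by (simp cong: measurable_cong_sets add: sets_prior)

lemma kernel_subprob [measurable]: "snd Z \<in> D \<rightarrow>\<^sub>M subprob_algebra (fst Z)"
  by (rule measurable_prob_algebraD[OF kernel_prob])

lemma joint_kernel [measurable]:
  "(\<lambda>v. distr (snd Z v) (D \<Otimes>\<^sub>M fst Z) (Pair v)) \<in> D \<rightarrow>\<^sub>M subprob_algebra (D \<Otimes>\<^sub>M fst Z)"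
  by (rule measurable_distr2[where M="fst Z"]) simp_all

lemma Pair_measurable:
  assumes "v \<in> space D"
  shows "Pair v \<in> snd Z v \<rightarrow>\<^sub>M D \<Otimes>\<^sub>M fst Z"
proof -
  have [measurable_cong]: "sets (snd Z v) = sets (fst Z)"
    by (rule sets_kernel[OF kernel_subprob assms])
  show ?thesis using assms by measurable
qed

lemma sets_J [measurable_cong, simp]: "sets J = sets (D \<Otimes>\<^sub>M fst Z)"
  unfolding joint_law_def
  by (rule sets_bind[OF sets_kernel[OF joint_kernel] prior.not_empty])

lemma space_J: "space J = {0..1} \<times> space (fst Z)"
  using sets_eq_imp_space_eq[OF sets_J] by (simp add: space_pair_measure space_prior)

lemma prob_space_kernel: "v \<in> space D \<Longrightarrow> prob_space (snd Z v)"
  using measurable_space[OF kernel_prob] by (simp add: space_prob_algebra)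

sublocale joint: prob_space J
  unfolding joint_law_def
proof (rule prior.prob_space_bind[OF _ joint_kernel])
  show "AE v in D. prob_space (distr (snd Z v) (D \<Otimes>\<^sub>M fst Z) (Pair v))"
    by (intro AE_I2 prob_space.prob_space_distr prob_space_kernel Pair_measurable)
qed

lemma prob_space_J: "prob_space J"
  by unfold_locales

lemma nn_integral_J:
  assumes "f \<in> borel_measurable (D \<Otimes>\<^sub>M fst Z)"
  shows "(\<integral>\<^sup>+x. f x \<partial>J) = (\<integral>\<^sup>+v. \<integral>\<^sup>+s. f (v, s) \<partial>snd Z v \<partial>D)"
  unfolding joint_law_def nn_integral_bind[OF assms joint_kernel]
  by (intro nn_integral_cong nn_integral_distr Pair_measurable) (simp_all add: assms)

lemma nn_integral_J_fst:
  assumes [measurable]: "f \<in> borel_measurable D"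
  shows "(\<integral>\<^sup>+x. f (fst x) \<partial>J) = (\<integral>\<^sup>+v. f v \<partial>D)"
proof -
  have "(\<integral>\<^sup>+x. f (fst x) \<partial>J) = (\<integral>\<^sup>+v. \<integral>\<^sup>+s. f v \<partial>snd Z v \<partial>D)"
    by (subst nn_integral_J) simp_all
  also have "\<dots> = (\<integral>\<^sup>+v. f v \<partial>D)"
    using prob_space.emeasure_space_1[OF prob_space_kernel]
    by (intro nn_integral_cong) simp
  finally show ?thesis .
qed

text \<open>The kernel has total mass one, so integrating out the signal returns the prior. Null
  sets and expectations of the value thereby pass between \<open>D\<close> and
  \<open>J\<close>.\<close>

lemma distr_J_fst: "distr J D fst = D"
proof (rule measure_eqI)
  fix A assume "A \<in> sets (distr J D fst)"
  then have [measurable]: "A \<in> sets D" by simp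
  have "emeasure (distr J D fst) A = (\<integral>\<^sup>+v. indicator A v \<partial>distr J D fst)"
    by simp
  also have "\<dots> = (\<integral>\<^sup>+x. indicator A (fst x) \<partial>J)"
    by (rule nn_integral_distr) simp_all
  also have "\<dots> = emeasure D A"
    by (subst nn_integral_J_fst) simp_all
  finally show "emeasure (distr J D fst) A = emeasure D A" .
qed simp

lemma AE_J_fst:
  assumes "AE v in D. P v"
  shows "AE x in J. P (fst x)"
proof (rule AE_distrD[of fst J D])
  show "AE v in distr J D fst. P v"
    unfolding distr_J_fst by (rule assms)
qed simp

abbreviation "F \<equiv> vimage_algebra (space J) snd (fst Z)"

text \<open>Makes the theory of \<open>real_cond_exp\<close> available for conditioning on the
  signal, that is, on the sigma-algebra pulled back along \<open>snd\<close>.\<close>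

sublocale signal: finite_measure_subalgebra J F
proof
  show "subalgebra J F"
    unfolding subalgebra_def
  proof (intro conjI)
    have "snd \<in> J \<rightarrow>\<^sub>M fst Z" by measurable
    from measurable_sets[OF this] show "sets F \<subseteq> sets J"
      by (subst sets_vimage_algebra2) (auto simp: space_J)
  qed simp
qed

lemma cond_signal_measurable [measurable]: "cond_signal D Z f \<in> borel_measurable (D \<Otimes>\<^sub>M fst Z)"
  unfolding cond_signal_def by measurable

text \<open>Almost surely the integrand is the constant 1, which is its own conditional expectation.
  Only an almost sure hypothesis can be used, since a utility is prescribed at 0 and 1
  alone.\<close>

lemma cond_signal_eq_1:
  assumes f [measurable]: "f \<in> borel_measurable unit_interval" and ae: "AE v in D. f v = 1"
  shows "AE x in J. cond_signal D Z f x = 1"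
proof -
  have "AE x in J. real_cond_exp J F (\<lambda>x. f (fst x)) x = real_cond_exp J F (\<lambda>_. 1) x"
    by (rule signal.real_cond_exp_cong[OF AE_J_fst[OF ae]]) measurable
  moreover have "AE x in J. real_cond_exp J F (\<lambda>_. 1) x = (1::real)"
    by (rule signal.real_cond_exp_F_meas) simp_all
  ultimately show ?thesis
    unfolding cond_signal_def by eventually_elim simp
qed

lemma fst_integrable: "integrable J (\<lambda>x. fst x)"
  by (rule joint.integrable_const_bound[where B=1]) (auto intro!: AE_I2 simp: space_J)

lemma posterior_mean_bounds: "AE x in J. 0 \<le> E x \<and> E x \<le> 1"
proof -
  have "AE x in J. E x \<ge> 0"
    unfolding cond_signal_def
    by (rule signal.real_cond_exp_ge_c[OF fst_integrable]) (auto simp: space_J)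
  moreover have "AE x in J. E x \<le> 1"
    unfolding cond_signal_def
    by (rule signal.real_cond_exp_le_c[OF fst_integrable]) (auto simp: space_J)
  ultimately show ?thesis by eventually_elim simp
qed

lemma integrable_posterior_mean: "integrable J E"
  unfolding cond_signal_def by (rule signal.real_cond_exp_int[OF fst_integrable])

text \<open>The tower property (Bayes plausibility): whatever the scheme, the posterior means
  average to the prior mean. This is what caps the gain from a deviation.\<close>

lemma integral_posterior_mean: "(\<integral>x. E x \<partial>J) = (\<integral>v. v \<partial>D)"
proof -
  have "(\<integral>x. E x \<partial>J) = (\<integral>x. fst x \<partial>J)"
    unfolding cond_signal_def by (rule signal.real_cond_exp_int[OF fst_integrable])
  also have "\<dots> = (\<integral>v. v \<partial>distr J D fst)"
    by (rule integral_distr[symmetric]) simp_all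
  finally show ?thesis by (simp add: distr_J_fst)
qed

end

lemma integral_id_bernoulli_prior:
  "0 \<le> \<zeta> \<Longrightarrow> \<zeta> \<le> 1 \<Longrightarrow> (\<integral>v. v \<partial>bernoulli_prior \<zeta>) = \<zeta>"
  by (subst integral_bernoulli_prior) simp_all

lemma agent_bernoulli: "is_scheme Z \<Longrightarrow> agent (bernoulli_prior \<zeta>) Z"
  by (simp add: agent_def agent_axioms_def prob_space_bernoulli_prior)

section \<open>Selection probabilities and tie breaking\<close>

lemma selection_prob_nonneg: "0 \<le> selection_prob N e i"
  by (simp add: selection_prob_def Let_def)

text \<open>Tie breaking is bounded away: being selected requires being a weak maximum. All later
  upper bounds work with this event.\<close>

lemma selection_prob_le:
  "selection_prob N e i \<le> of_bool (\<forall>l<N. e l \<le> e i)"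
proof -
  have "1 / real n \<le> 1" for n by (cases n) auto
  then show ?thesis by (simp add: selection_prob_def Let_def)
qed

lemma sum_selection_prob:
  assumes "N \<ge> 1"
  shows "(\<Sum>i<N. selection_prob N e i) = 1"
proof -
  define T where "T = {j. j < N \<and> (\<forall>l<N. e l \<le> e j)}"
  have fin: "finite T" by (simp add: T_def)
  have "Max (e ` {..<N}) \<in> e ` {..<N}"
    using assms by (intro Max_in) (auto simp: lessThan_empty_iff)
  then obtain j where j: "j < N" "e j = Max (e ` {..<N})" by auto
  have "j \<in> T" unfolding T_def using j by auto
  then have card: "card T > 0" using fin by (auto simp: card_gt_0_iff)
  have "(\<Sum>i<N. selection_prob N e i) = (\<Sum>i<N. if i \<in> T then 1 / real (card T) else 0)"
    by (simp add: selection_prob_def Let_def flip: T_def)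
  also have "\<dots> = (\<Sum>i\<in>T. 1 / real (card T))"
    by (rule sum.mono_neutral_cong_right) (auto simp: T_def)
  also have "\<dots> = 1" using card by simp
  finally show ?thesis .
qed

text \<open>The size of the tie set becomes a finite sum of indicators, a form from which
  measurability in the outcome can be derived.\<close>

lemma selection_prob_altdef:
  assumes "i < N"
  shows "selection_prob N e i = (if \<forall>l\<in>{..<N}. e l \<le> e i
    then 1 / (\<Sum>j<N. if \<forall>l\<in>{..<N}. e l \<le> e j then 1 else 0) else 0)"
proof -
  have "{j. j < N \<and> (\<forall>l<N. e l \<le> e j)} = {..<N} \<inter> {j. \<forall>l\<in>{..<N}. e l \<le> e j}" by auto
  then show ?thesis
    using assms by (simp add: selection_prob_def Let_def sum.If_cases)
qed

lemma pred_le_real: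
  fixes f g :: "'a \<Rightarrow> real"
  assumes [measurable]: "f \<in> borel_measurable M" "g \<in> borel_measurable M"
  shows "Measurable.pred M (\<lambda>x. f x \<le> g x)"
  by measurable

section \<open>Profiles of independent agents with a common prior and individual schemes\<close>

locale agents =
  fixes N :: nat and D :: "real measure" and Z :: "nat \<Rightarrow> 's scheme"
  assumes agent: "i < N \<Longrightarrow> agent D (Z i)"
    and agents_nonempty: "N \<ge> 1"
begin

abbreviation "\<Omega> \<equiv> outcome_law N (\<lambda>_. D) Z"
abbreviation "JJ i \<equiv> joint_law D (Z i)"
abbreviation "EE i \<equiv> posterior_mean D (Z i)"

lemma prob_space_JJ: "i < N \<Longrightarrow> prob_space (JJ i)"
  using agent by (simp add: agent.prob_space_J)

lemma EE_measurable: "i < N \<Longrightarrow> EE i \<in> borel_measurable (JJ i)"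
  using agent.cond_signal_measurable[OF agent] agent.sets_J[OF agent]
  by (simp cong: measurable_cong_sets)

lemma prob_space_outcome: "prob_space \<Omega>"
  unfolding outcome_law_def by (rule prob_space_PiM) (simp add: prob_space_JJ)

lemma component_measurable: "i < N \<Longrightarrow> (\<lambda>\<omega>. \<omega> i) \<in> \<Omega> \<rightarrow>\<^sub>M JJ i"
  unfolding outcome_law_def by (rule measurable_component_singleton) simp

lemma distr_component: "i < N \<Longrightarrow> distr \<Omega> (JJ i) (\<lambda>\<omega>. \<omega> i) = JJ i"
  unfolding outcome_law_def by (rule distr_PiM_component) (simp_all add: prob_space_JJ)

lemma AE_component: "i < N \<Longrightarrow> AE x in JJ i. P x \<Longrightarrow> AE \<omega> in \<Omega>. P (\<omega> i)"
  unfolding outcome_law_def by (rule AE_PiM_component) (simp_all add: prob_space_JJ)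

lemma integrable_component:
  fixes f :: "real \<times> 's \<Rightarrow> real"
  assumes "i < N" "integrable (JJ i) f"
  shows "integrable \<Omega> (\<lambda>\<omega>. f (\<omega> i))"
  using integrable_distr[OF component_measurable[OF assms(1)], of f] assms
  by (simp add: distr_component)

lemma integral_component:
  fixes f :: "real \<times> 's \<Rightarrow> real"
  assumes "i < N" "f \<in> borel_measurable (JJ i)"
  shows "(\<integral>\<omega>. f (\<omega> i) \<partial>\<Omega>) = (\<integral>x. f x \<partial>JJ i)"
  using integral_distr[OF component_measurable assms(2)] assms
  by (simp add: distr_component)

lemma EE_component_measurable:
  "i < N \<Longrightarrow> (\<lambda>\<omega>. EE i (\<omega> i)) \<in> borel_measurable \<Omega>"
  by (rule measurable_compose[OF component_measurable EE_measurable])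

lemma AE_posterior_bounds: "AE \<omega> in \<Omega>. \<forall>i\<in>{..<N}. 0 \<le> EE i (\<omega> i) \<and> EE i (\<omega> i) \<le> 1"
proof (subst AE_finite_all)
  show "\<forall>i\<in>{..<N}. AE \<omega> in \<Omega>. 0 \<le> EE i (\<omega> i) \<and> EE i (\<omega> i) \<le> 1"
  proof
    fix i assume "i \<in> {..<N}"
    then have i: "i < N" by simp
    show "AE \<omega> in \<Omega>. 0 \<le> EE i (\<omega> i) \<and> EE i (\<omega> i) \<le> 1"
      by (rule AE_component[OF i agent.posterior_mean_bounds[OF agent[OF i]]])
  qed
qed simp

lemma max_measurable:
  "(\<lambda>\<omega>. Max ((\<lambda>j. EE j (\<omega> j)) ` {..<N})) \<in> borel_measurable \<Omega>"
  by (rule borel_measurable_Max) (auto intro: EE_component_measurable)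

lemma selection_prob_measurable:
  assumes i: "i < N"
  shows "(\<lambda>\<omega>. selection_prob N (\<lambda>j. EE j (\<omega> j)) i) \<in> borel_measurable \<Omega>"
proof -
  have [measurable]: "Measurable.pred \<Omega> (\<lambda>\<omega>. \<forall>l\<in>{..<N}. EE l (\<omega> l) \<le> EE j (\<omega> j))"
    if "j < N" for j
    using that
    by (intro pred_intros_finite) (auto intro!: pred_le_real EE_component_measurable)
  show ?thesis
    unfolding selection_prob_altdef[OF i] using i by measurable
qed

text \<open>The maximum dominates the posterior mean of agent 0, whose expectation is the prior
  mean. This bounds the welfare of every equilibrium away from 0.\<close>

lemma welfare_ge: "(\<integral>v. v \<partial>D) \<le> welfare N (\<lambda>_. D) Z"
proof -
  interpret prob_space \<Omega> by (rule prob_space_outcome)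
  have 0: "0 < N" using agents_nonempty by simp
  have "(\<integral>v. v \<partial>D) = (\<integral>\<omega>. EE 0 (\<omega> 0) \<partial>\<Omega>)"
    using integral_component[OF 0 EE_measurable[OF 0]]
      agent.integral_posterior_mean[OF agent[OF 0]] by simp
  also have "\<dots> \<le> welfare N (\<lambda>_. D) Z"
    unfolding welfare_def
  proof (rule integral_mono)
    show "integrable \<Omega> (\<lambda>\<omega>. EE 0 (\<omega> 0))"
      by (rule integrable_component[OF 0 agent.integrable_posterior_mean[OF agent[OF 0]]])
    show "integrable \<Omega> (\<lambda>\<omega>. Max ((\<lambda>j. EE j (\<omega> j)) ` {..<N}))"
    proof (rule integrable_const_bound[where B=1, OF _ max_measurable])
      show "AE \<omega> in \<Omega>. norm (Max ((\<lambda>j. EE j (\<omega> j)) ` {..<N})) \<le> 1"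
        using AE_posterior_bounds
      proof eventually_elim
        case (elim \<omega>)
        have "Max ((\<lambda>j. EE j (\<omega> j)) ` {..<N}) \<in> (\<lambda>j. EE j (\<omega> j)) ` {..<N}"
          using 0 by (intro Max_in) (auto simp: lessThan_empty_iff)
        with elim show ?case by auto
      qed
    qed
    show "EE 0 (\<omega> 0) \<le> Max ((\<lambda>j. EE j (\<omega> j)) ` {..<N})" for \<omega>
      using 0 by (intro Max_ge) auto
  qed
  finally show ?thesis .
qed

text \<open>Given agent \<open>i\<close>'s pair \<open>y\<close>, the \<open>N - 1\<close> rivals
  are independent, and each stays below \<open>x = EE i y\<close> with probability at most
  \<open>root (N - 1) (x / c)\<close>. The product of these bounds is \<open>x / c\<close>. The
  weight \<open>f = 1\<close> gives a bound on her winning probability, the weight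
  \<open>f = EE i\<close> one on her share of the welfare.\<close>

lemma nn_integral_top_le:
  assumes i: "i < N" and N: "N \<ge> 2" and c: "c > 0"
    and rivals: "\<And>j x. j < N \<Longrightarrow> j \<noteq> i \<Longrightarrow> 0 \<le> x \<Longrightarrow>
      emeasure (JJ j) {y \<in> space (JJ j). EE j y \<le> x} \<le> ennreal (root (N - 1) (x / c))"
    and f: "f \<in> borel_measurable (JJ i)"
  shows "(\<integral>\<^sup>+\<omega>. f (\<omega> i) * of_bool (\<forall>l<N. EE l (\<omega> l) \<le> EE i (\<omega> i)) \<partial>\<Omega>)
    \<le> (\<integral>\<^sup>+y. f y * ennreal (EE i y / c) \<partial>JJ i)"
proof -
  \<comment> \<open>The product-space locale demands a probability space at every index, so indices
    from \<open>N\<close> on get the dummy \<open>JJ i\<close>.\<close>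
  define M where "M j = (if j < N then JJ j else JJ i)" for j
  define I where "I = {..<N} - {i}"
  define g :: "nat \<Rightarrow> real \<Rightarrow> real \<times> 's \<Rightarrow> ennreal" where
    "g j x y = of_bool (EE j y \<le> x)" for j x y
  have I: "finite I" "i \<notin> I" "insert i I = {..<N}" "card I = N - 1"
    using i by (auto simp: I_def)
  have IN: "j < N" "j \<noteq> i" if "j \<in> I" for j using that by (auto simp: I_def)
  have MJ: "M j = JJ j" if "j < N" for j using that by (simp add: M_def)
  have "prob_space (M j)" for j
    using i by (simp add: M_def prob_space_JJ)
  then interpret product_prob_space M UNIV
    by (simp add: product_prob_space_def product_prob_space_axioms_def product_sigma_finite_def
        prob_space_imp_sigma_finite)
  have \<Omega>: "\<Omega> = PiM (insert i I) M"
    unfolding outcome_law_def I by (rule PiM_cong) (auto simp: MJ)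
  have EM [measurable]: "EE j \<in> borel_measurable (M j)" if "j < N" for j
    using EE_measurable[OF that] by (simp add: MJ that)
  have fM [measurable]: "f \<in> borel_measurable (M i)"
    using f by (simp add: MJ i)
  have gM: "g j x \<in> borel_measurable (M j)" if "j \<in> I" for j x
    using EM[OF IN(1)[OF that]] unfolding g_def by measurable
  have comp [measurable]: "(\<lambda>\<omega>. \<omega> j) \<in> PiM (insert i I) M \<rightarrow>\<^sub>M M j" if "j < N" for j
    using that by (intro measurable_component_singleton) (simp add: I)
  have meas: "(\<lambda>\<omega>. f (\<omega> i) * (\<Prod>j\<in>I. g j (EE i (\<omega> i)) (\<omega> j))) \<in> borel_measurable (PiM (insert i I) M)"
  proof (intro borel_measurable_times_ennreal borel_measurable_prod_ennreal)
    show "(\<lambda>\<omega>. f (\<omega> i)) \<in> borel_measurable (PiM (insert i I) M)"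
      by (rule measurable_compose[OF comp[OF i] fM])
    fix j assume j: "j \<in> I"
    have EEj: "(\<lambda>\<omega>. EE j (\<omega> j)) \<in> borel_measurable (PiM (insert i I) M)"
      by (rule measurable_compose[OF comp EM]) (use IN j in auto)
    have EEi: "(\<lambda>\<omega>. EE i (\<omega> i)) \<in> borel_measurable (PiM (insert i I) M)"
      by (rule measurable_compose[OF comp EM]) (use i in auto)
    show "(\<lambda>\<omega>. g j (EE i (\<omega> i)) (\<omega> j)) \<in> borel_measurable (PiM (insert i I) M)"
      unfolding g_def using pred_le_real[OF EEj EEi] by measurable
  qed
  have "(\<integral>\<^sup>+\<omega>. f (\<omega> i) * of_bool (\<forall>l<N. EE l (\<omega> l) \<le> EE i (\<omega> i)) \<partial>\<Omega>)
      = (\<integral>\<^sup>+\<omega>. f (\<omega> i) * (\<Prod>j\<in>I. g j (EE i (\<omega> i)) (\<omega> j)) \<partial>PiM (insert i I) M)"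
    unfolding \<Omega>
  proof (rule nn_integral_cong)
    fix \<omega>
    have "of_bool (\<forall>l<N. EE l (\<omega> l) \<le> EE i (\<omega> i)) = (\<Prod>j\<in>I. g j (EE i (\<omega> i)) (\<omega> j))"
    proof (cases "\<forall>l<N. EE l (\<omega> l) \<le> EE i (\<omega> i)")
      case True
      then show ?thesis by (auto simp: g_def I_def intro!: prod.neutral[symmetric])
    next
      case False
      then have "\<exists>j\<in>I. g j (EE i (\<omega> i)) (\<omega> j) = 0"
        by (auto simp: g_def I_def)
      then have "(\<Prod>j\<in>I. g j (EE i (\<omega> i)) (\<omega> j)) = 0" by (rule prod_zero[OF I(1)])
      moreover have "of_bool (\<forall>l<N. EE l (\<omega> l) \<le> EE i (\<omega> i)) = (0 :: ennreal)"
        using False by (simp only: of_bool_def if_False)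
      ultimately show ?thesis by (simp only:)
    qed
    then show "f (\<omega> i) * of_bool (\<forall>l<N. EE l (\<omega> l) \<le> EE i (\<omega> i))
      = f (\<omega> i) * (\<Prod>j\<in>I. g j (EE i (\<omega> i)) (\<omega> j))" by simp
  qed
  \<comment> \<open>Fubini with agent \<open>i\<close>'s coordinate \<open>y\<close> outermost:
    inside, the threshold \<open>EE i y\<close> is a constant and the rivals' factors
    separate.\<close>
  also have "\<dots> = (\<integral>\<^sup>+y. \<integral>\<^sup>+\<omega>. f y * (\<Prod>j\<in>I. g j (EE i y) (\<omega> j)) \<partial>PiM I M \<partial>M i)"
  proof (subst product_nn_integral_insert_rev[OF I(1,2) meas], intro nn_integral_cong)
    fix y \<omega>
    have "(\<Prod>j\<in>I. g j (EE i ((fun_upd \<omega> i y) i)) ((fun_upd \<omega> i y) j)) = (\<Prod>j\<in>I. g j (EE i y) (\<omega> j))"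
      by (rule prod.cong) (auto simp: I_def)
    then show "f ((fun_upd \<omega> i y) i) * (\<Prod>j\<in>I. g j (EE i ((fun_upd \<omega> i y) i)) ((fun_upd \<omega> i y) j))
        = f y * (\<Prod>j\<in>I. g j (EE i y) (\<omega> j))" by simp
  qed
  also have "\<dots> = (\<integral>\<^sup>+y. f y * (\<Prod>j\<in>I. \<integral>\<^sup>+z. g j (EE i y) z \<partial>M j) \<partial>M i)"
  proof (rule nn_integral_cong)
    fix y
    have "(\<lambda>\<omega>. \<Prod>j\<in>I. g j (EE i y) (\<omega> j)) \<in> borel_measurable (PiM I M)"
    proof (rule borel_measurable_prod_ennreal)
      fix j assume "j \<in> I"
      then show "(\<lambda>\<omega>. g j (EE i y) (\<omega> j)) \<in> borel_measurable (PiM I M)"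
        by (intro measurable_compose[OF measurable_component_singleton] gM)
    qed
    then have "(\<integral>\<^sup>+\<omega>. f y * (\<Prod>j\<in>I. g j (EE i y) (\<omega> j)) \<partial>PiM I M)
      = f y * (\<integral>\<^sup>+\<omega>. (\<Prod>j\<in>I. g j (EE i y) (\<omega> j)) \<partial>PiM I M)"
      by (rule nn_integral_cmult)
    also have "(\<integral>\<^sup>+\<omega>. (\<Prod>j\<in>I. g j (EE i y) (\<omega> j)) \<partial>PiM I M)
      = (\<Prod>j\<in>I. \<integral>\<^sup>+z. g j (EE i y) z \<partial>M j)"
      by (rule product_nn_integral_prod[OF I(1) gM])
    finally show "(\<integral>\<^sup>+\<omega>. f y * (\<Prod>j\<in>I. g j (EE i y) (\<omega> j)) \<partial>PiM I M)
      = f y * (\<Prod>j\<in>I. \<integral>\<^sup>+z. g j (EE i y) z \<partial>M j)" .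
  qed
  also have "\<dots> \<le> (\<integral>\<^sup>+y. f y * ennreal (EE i y / c) \<partial>M i)"
  proof (rule nn_integral_mono_AE)
    \<comment> \<open>The hypothesis on the rivals covers nonnegative thresholds only, and the
      conditional expectation is nonnegative only almost everywhere.\<close>
    have "AE y in M i. 0 \<le> EE i y \<and> EE i y \<le> 1"
      unfolding MJ[OF i] by (rule agent.posterior_mean_bounds[OF agent[OF i]])
    then show "AE y in M i. f y * (\<Prod>j\<in>I. \<integral>\<^sup>+z. g j (EE i y) z \<partial>M j) \<le> f y * ennreal (EE i y / c)"
    proof eventually_elim
      case (elim y)
      then have x: "0 \<le> EE i y" by simp
      have "(\<Prod>j\<in>I. \<integral>\<^sup>+z. g j (EE i y) z \<partial>M j) \<le> (\<Prod>j\<in>I. ennreal (root (N - 1) (EE i y / c)))"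
      proof (rule prod_mono_ennreal)
        fix j assume j: "j \<in> I"
        note [measurable] = EM[OF IN(1)[OF j]]
        have "(\<integral>\<^sup>+z. g j (EE i y) z \<partial>M j)
            = (\<integral>\<^sup>+z. indicator {z \<in> space (M j). EE j z \<le> EE i y} z \<partial>M j)"
          by (rule nn_integral_cong) (simp add: g_def indicator_def)
        also have "\<dots> = emeasure (M j) {z \<in> space (M j). EE j z \<le> EE i y}"
          by (rule nn_integral_indicator) measurable
        also have "\<dots> \<le> ennreal (root (N - 1) (EE i y / c))"
          using rivals[OF IN[OF j] x] by (simp add: MJ IN[OF j])
        finally show "(\<integral>\<^sup>+z. g j (EE i y) z \<partial>M j) \<le> ennreal (root (N - 1) (EE i y / c))" .
      qed
      also have "\<dots> = ennreal (root (N - 1) (EE i y / c) ^ (N - 1))"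
        using x c by (simp add: I ennreal_power real_root_ge_zero)
      \<comment> \<open>The power cancels the root because \<open>N \<ge> 2\<close> makes the
        exponent \<open>N - 1\<close> positive.\<close>
      also have "\<dots> = ennreal (EE i y / c)"
        using x c N by (simp add: real_root_pow_pos2)
      finally show ?case by (rule mult_left_mono) simp
    qed
  qed
  also have "M i = JJ i" by (rule MJ[OF i])
  finally show ?thesis .
qed

end

section \<open>The linear scheme and the law of its posterior mean\<close>

text \<open>Signals must live in the type \<open>'s\<close>, so the real line with its Borel sets is
  transported there along an injection.\<close>

definition signal_space :: "(real \<Rightarrow> 's) \<Rightarrow> 's measure" where
  "signal_space emb = vimage_algebra (range emb) (inv emb) borel"

text \<open>Bayes' rule for a uniform signal \<open>t\<close> with posterior
  \<open>p = N * \<zeta> * t ^ (N - 1)\<close>: the density of \<open>t\<close> is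
  \<open>p / \<zeta>\<close> given value 1 and \<open>(1 - p) / (1 - \<zeta>)\<close> given value 0.
  All other values form a prior null set and are treated like 0, so that the kernel is defined on
  the whole interval.\<close>

definition signal_density :: "nat \<Rightarrow> real \<Rightarrow> real \<Rightarrow> real \<Rightarrow> real" where
  "signal_density N \<zeta> v t =
     (if v = 1 then real N * t ^ (N - 1) else (1 - real N * \<zeta> * t ^ (N - 1)) / (1 - \<zeta>))"

text \<open>The name refers to the bound \<open>x / (N * \<zeta>)\<close>, linear in the posterior
  mean \<open>x\<close>, on the probability of winning against \<open>N - 1\<close> rivals with this
  scheme.\<close>

definition linear_scheme :: "(real \<Rightarrow> 's) \<Rightarrow> nat \<Rightarrow> real \<Rightarrow> 's scheme" where
  "linear_scheme emb N \<zeta> = (signal_space emb, \<lambda>v. distr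
     (density lborel (\<lambda>t. ennreal (signal_density N \<zeta> v t) * indicator {0..1} t))
     (signal_space emb) emb)"

lemma nn_integral_power_Icc:
  "(\<integral>\<^sup>+t. ennreal (t ^ n) * indicator {0..1} t \<partial>lborel) = ennreal (1 / real (Suc n))"
proof -
  have "(\<integral>\<^sup>+t. ennreal (t ^ n) * indicator {0..1} t \<partial>lborel)
      = ennreal (1 ^ Suc n / real (Suc n) - 0 ^ Suc n / real (Suc n))"
  proof (rule nn_integral_FTC_Icc)
    show "((\<lambda>t. t ^ Suc n / real (Suc n)) has_real_derivative t ^ n) (at t)" for t
      by (rule DERIV_cong[OF DERIV_cdivide[OF DERIV_pow]]) (simp del: of_nat_Suc)
  qed auto
  then show ?thesis by simp
qed

text \<open>\<open>N \<ge> 2\<close> yields \<open>\<zeta> < 1\<close>, so the density given value 0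
  has a nonzero denominator, and \<open>N - 1 > 0\<close>, so \<open>t ^ (N - 1)\<close> can be
  inverted by a root. The condition \<open>N * \<zeta> \<le> 1\<close> keeps the posterior at most
  1.\<close>

locale linear_signal =
  fixes emb :: "real \<Rightarrow> 's" and N :: nat and \<zeta> :: real
  assumes emb: "inj emb" and N: "N \<ge> 2" and \<zeta>: "0 < \<zeta>" "real N * \<zeta> \<le> 1"
begin

abbreviation "S \<equiv> signal_space emb"
abbreviation "D \<equiv> bernoulli_prior \<zeta>"
abbreviation "LS \<equiv> linear_scheme emb N \<zeta>"

lemma \<zeta>_less_1: "\<zeta> < 1"
proof -
  have "2 * \<zeta> \<le> real N * \<zeta>" using N \<zeta> by (intro mult_right_mono) auto
  then show ?thesis using \<zeta> by linarith
qed

lemma measurable_inv_embed [measurable]: "inv emb \<in> S \<rightarrow>\<^sub>M borel"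
  unfolding signal_space_def by (rule measurable_vimage_algebra1) simp

lemma measurable_embed [measurable]: "emb \<in> borel \<rightarrow>\<^sub>M S"
  unfolding signal_space_def
  by (rule measurable_vimage_algebra2) (simp_all add: emb)

lemma density_nonneg: "t \<in> {0..1} \<Longrightarrow> 0 \<le> real N * \<zeta> * t ^ (N - 1) \<and> real N * \<zeta> * t ^ (N - 1) \<le> 1"
  using \<zeta> N by (auto intro!: mult_le_one power_le_one)

lemma measurable_signal_density [measurable]: "signal_density N \<zeta> v \<in> borel_measurable borel"
  unfolding signal_density_def by measurable

lemma nn_integral_signal_density:
  "(\<integral>\<^sup>+t. ennreal (signal_density N \<zeta> v t) * indicator {0..1} t \<partial>lborel) = 1"
proof -
  \<comment> \<open>An antiderivative of the density in \<open>t\<close>; it rises from 0 at 0 to 1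
    at 1 in both cases.\<close>
  define P where "P t = (if v = 1 then t ^ N else (t - \<zeta> * t ^ N) / (1 - \<zeta>))" for t :: real
  have "(\<integral>\<^sup>+t. ennreal (signal_density N \<zeta> v t) * indicator {0..1} t \<partial>lborel) = ennreal (P 1 - P 0)"
  proof (rule nn_integral_FTC_Icc)
    show "(P has_real_derivative signal_density N \<zeta> v t) (at t)" for t
      unfolding P_def signal_density_def using \<zeta>_less_1
      by (cases "v = 1") (auto intro!: derivative_eq_intros)
    show "0 \<le> signal_density N \<zeta> v t" if "t \<in> {0..1}" for t
      using density_nonneg[OF that] that \<zeta>_less_1 by (auto simp: signal_density_def)
  qed simp_all
  then show ?thesis
    using \<zeta>_less_1 N by (simp add: P_def)
qed

lemma is_scheme_LS: "is_scheme LS"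
proof -
  define K where "K v = distr
     (density lborel (\<lambda>t. ennreal (signal_density N \<zeta> v t) * indicator {0..1} t)) S emb" for v
  have K: "K v \<in> space (prob_algebra S)" for v
  proof -
    have "prob_space (density lborel (\<lambda>t. ennreal (signal_density N \<zeta> v t) * indicator {0..1} t))"
      by (rule prob_spaceI) (simp add: emeasure_density nn_integral_signal_density)
    then have "prob_space (K v)"
      unfolding K_def by (rule prob_space.prob_space_distr) simp
    then show ?thesis by (simp add: space_prob_algebra K_def)
  qed
  \<comment> \<open>The kernel takes only two values, so its measurability reduces to that of the
    set {1}.\<close>
  have eq: "K = (\<lambda>v. if v = 1 then K 1 else K 0)"
    by (auto simp: K_def signal_density_def)
  have "K \<in> unit_interval \<rightarrow>\<^sub>M prob_algebra S"
  proof (subst eq, rule measurable_If)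
    show "{v \<in> space unit_interval. v = 1} \<in> sets unit_interval"
      by (rule borel_measurable_eq) measurable
  qed (auto intro!: measurable_const K)
  then show ?thesis
    by (simp add: is_scheme_def linear_scheme_def flip: K_def)
qed

sublocale agent D LS
  by (rule agent_bernoulli[OF is_scheme_LS])

lemma fst_LS [simp]: "fst LS = S"
  by (simp add: linear_scheme_def)

lemmas sets_J_LS [measurable_cong] = sets_J[unfolded fst_LS]

text \<open>The joint law with the order of sampling reversed: first a uniform \<open>t\<close>,
  then value 1 with probability \<open>N * \<zeta> * t ^ (N - 1)\<close>. The prior weights cancel
  the denominators of the densities.\<close>

lemma nn_integral_LS:
  assumes f [measurable]: "f \<in> borel_measurable (D \<Otimes>\<^sub>M S)"
  shows "(\<integral>\<^sup>+x. f x \<partial>J) = (\<integral>\<^sup>+t. (ennreal (real N * \<zeta> * t ^ (N - 1)) * f (1, emb t)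
    + ennreal (1 - real N * \<zeta> * t ^ (N - 1)) * f (0, emb t)) * indicator {0..1} t \<partial>lborel)"
proof -
  have kern: "snd LS \<in> D \<rightarrow>\<^sub>M subprob_algebra S"
    using kernel_subprob by simp
  have meas: "(\<lambda>v. \<integral>\<^sup>+s. f (v, s) \<partial>snd LS v) \<in> borel_measurable unit_interval"
    using nn_integral_measurable_subprob_algebra2[OF _ kern, of "\<lambda>v s. f (v, s)"]
    by (simp cong: measurable_cong_sets)
  have fv: "(\<lambda>t. f (v, emb t)) \<in> borel_measurable borel" if "v \<in> {0, 1}" for v
  proof -
    have "(\<lambda>t. (v, emb t)) \<in> borel \<rightarrow>\<^sub>M D \<Otimes>\<^sub>M S"
      using that by (intro measurable_Pair measurable_const) (auto simp: space_prior)
    from measurable_compose[OF this f] show ?thesis .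
  qed
  note [measurable] = fv[of 0, simplified] fv[of 1, simplified]
  have inner: "(\<integral>\<^sup>+s. f (v, s) \<partial>snd LS v)
      = (\<integral>\<^sup>+t. ennreal (signal_density N \<zeta> v t) * indicator {0..1} t * f (v, emb t) \<partial>lborel)"
    if "v \<in> {0, 1}" for v
  proof -
    have "(\<lambda>s. f (v, s)) \<in> borel_measurable S"
      using that by (intro measurable_compose[OF measurable_Pair1' f]) (auto simp: space_prior)
    then show ?thesis
      using fv[OF that]
      by (simp add: linear_scheme_def nn_integral_distr nn_integral_density)
  qed
  have "(\<integral>\<^sup>+x. f x \<partial>J) = ennreal \<zeta> * (\<integral>\<^sup>+s. f (1, s) \<partial>snd LS 1)
      + ennreal (1 - \<zeta>) * (\<integral>\<^sup>+s. f (0, s) \<partial>snd LS 0)"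
    using \<zeta> \<zeta>_less_1 meas by (subst nn_integral_J) (simp_all add: nn_integral_bernoulli_prior)
  also have "\<dots> = (\<integral>\<^sup>+t. ennreal \<zeta> * (ennreal (signal_density N \<zeta> 1 t) * indicator {0..1} t * f (1, emb t))
     + ennreal (1 - \<zeta>) * (ennreal (signal_density N \<zeta> 0 t) * indicator {0..1} t * f (0, emb t)) \<partial>lborel)"
    by (simp add: inner nn_integral_add nn_integral_cmult)
  also have "\<dots> = (\<integral>\<^sup>+t. (ennreal (real N * \<zeta> * t ^ (N - 1)) * f (1, emb t)
    + ennreal (1 - real N * \<zeta> * t ^ (N - 1)) * f (0, emb t)) * indicator {0..1} t \<partial>lborel)"
  proof (rule nn_integral_cong)
    fix t :: real
    show "ennreal \<zeta> * (ennreal (signal_density N \<zeta> 1 t) * indicator {0..1} t * f (1, emb t))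
       + ennreal (1 - \<zeta>) * (ennreal (signal_density N \<zeta> 0 t) * indicator {0..1} t * f (0, emb t))
       = (ennreal (real N * \<zeta> * t ^ (N - 1)) * f (1, emb t)
        + ennreal (1 - real N * \<zeta> * t ^ (N - 1)) * f (0, emb t)) * indicator {0..1} t"
    proof (cases "t \<in> {0..1}")
      case True
      have "ennreal \<zeta> * ennreal (signal_density N \<zeta> 1 t) = ennreal (real N * \<zeta> * t ^ (N - 1))"
        using \<zeta> True by (simp add: signal_density_def ennreal_mult[symmetric] mult_ac)
      moreover have "ennreal (1 - \<zeta>) * ennreal (signal_density N \<zeta> 0 t) = ennreal (1 - real N * \<zeta> * t ^ (N - 1))"
        using \<zeta>_less_1 density_nonneg[OF True]
        by (simp add: signal_density_def ennreal_mult[symmetric])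
      ultimately show ?thesis using True by (simp add: mult.assoc[symmetric])
    qed simp
  qed
  finally show ?thesis .
qed

text \<open>The weights of the two values add up to 1 for each \<open>t\<close>, so the signal alone
  is uniform on [0, 1].\<close>

lemma nn_integral_LS_snd:
  assumes [measurable]: "h \<in> borel_measurable S"
  shows "(\<integral>\<^sup>+x. h (snd x) \<partial>J) = (\<integral>\<^sup>+t. h (emb t) * indicator {0..1} t \<partial>lborel)"
proof -
  have "(\<integral>\<^sup>+x. h (snd x) \<partial>J) = (\<integral>\<^sup>+t. (ennreal (real N * \<zeta> * t ^ (N - 1)) * h (emb t)
    + ennreal (1 - real N * \<zeta> * t ^ (N - 1)) * h (emb t)) * indicator {0..1} t \<partial>lborel)"
    by (subst nn_integral_LS) simp_all
  also have "\<dots> = (\<integral>\<^sup>+t. h (emb t) * indicator {0..1} t \<partial>lborel)"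
  proof (rule nn_integral_cong)
    fix t :: real
    have "ennreal (real N * \<zeta> * t ^ (N - 1)) + ennreal (1 - real N * \<zeta> * t ^ (N - 1)) = 1"
      if "t \<in> {0..1}"
      using density_nonneg[OF that] by (simp add: ennreal_plus[symmetric] del: ennreal_plus)
    then show "(ennreal (real N * \<zeta> * t ^ (N - 1)) * h (emb t)
      + ennreal (1 - real N * \<zeta> * t ^ (N - 1)) * h (emb t)) * indicator {0..1} t
      = h (emb t) * indicator {0..1} t"
      by (auto simp: indicator_def distrib_right[symmetric])
  qed
  finally show ?thesis .
qed

text \<open>The conditional expectation is identified by testing on signal events: over the event
  that the signal lies in \<open>B\<close>, both the value and the claimed function integrate
  \<open>N * \<zeta> * t ^ (N - 1)\<close> over the \<open>t\<close> with \<open>emb t\<close> in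
  \<open>B\<close>.\<close>

lemma posterior_mean_LS:
  "AE x in J. E x = real N * \<zeta> * (inv emb (snd x)) ^ (N - 1)"
proof -
  \<comment> \<open>Signals outside \<open>emb ` {0..1}\<close> are null; clamping makes \<open>g\<close> bounded everywhere.\<close>
  define g where "g s = real N * \<zeta> * (min 1 (max 0 (inv emb s))) ^ (N - 1)" for s
  have g_bounds: "0 \<le> g s" "g s \<le> 1" for s
    using density_nonneg[of "min 1 (max 0 (inv emb s))"] by (auto simp: g_def)
  have [measurable]: "g \<in> borel_measurable S" unfolding g_def by measurable
  have sndF: "snd \<in> F \<rightarrow>\<^sub>M S"
    unfolding fst_LS by (rule measurable_vimage_algebra1) (auto simp: space_J)
  have intg: "integrable J (\<lambda>x. g (snd x))"
    by (rule joint.integrable_const_bound[where B=1]) (auto simp: g_bounds)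
  have "AE x in J. real_cond_exp J F (\<lambda>x. fst x) x = g (snd x)"
  proof (rule signal.real_cond_exp_charact[OF _ fst_integrable intg])
    show "(\<lambda>x. g (snd x)) \<in> borel_measurable F"
      by (rule measurable_compose[OF sndF]) simp
    fix A assume "A \<in> sets F"
    moreover have "sets F = {snd -` B \<inter> space J | B. B \<in> sets S}"
      unfolding fst_LS by (rule sets_vimage_algebra2) (auto simp: space_J)
    ultimately obtain B where B [measurable]: "B \<in> sets S" and A: "A = snd -` B \<inter> space J"
      by blast
    have ind: "indicator A x = (indicator B (snd x) :: real)" if "x \<in> space J" for x
      using that by (auto simp: A indicator_def)
    have "(\<integral>x\<in>A. fst x \<partial>J) = (\<integral>x. indicator B (snd x) * fst x \<partial>J)"
      unfolding set_lebesgue_integral_def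
      by (rule Bochner_Integration.integral_cong) (auto simp: ind)
    also have "\<dots> = enn2real (\<integral>\<^sup>+x. ennreal (indicator B (snd x) * fst x) \<partial>J)"
      by (rule integral_eq_nn_integral) (auto intro!: AE_I2 simp: space_J)
    also have "(\<integral>\<^sup>+x. ennreal (indicator B (snd x) * fst x) \<partial>J)
      = (\<integral>\<^sup>+t. ennreal (real N * \<zeta> * t ^ (N - 1)) * indicator B (emb t) * indicator {0..1} t \<partial>lborel)"
      by (subst nn_integral_LS) (simp_all add: ennreal_indicator)
    also have "\<dots> = (\<integral>\<^sup>+t. ennreal (indicator B (emb t) * g (emb t)) * indicator {0..1} t \<partial>lborel)"
      by (intro nn_integral_cong) (auto simp: g_def emb indicator_def)
    also have "\<dots> = (\<integral>\<^sup>+x. ennreal (indicator B (snd x) * g (snd x)) \<partial>J)"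
      by (rule nn_integral_LS_snd[symmetric]) measurable
    also have "enn2real \<dots> = (\<integral>x. indicator B (snd x) * g (snd x) \<partial>J)"
      by (rule integral_eq_nn_integral[symmetric]) (auto simp: g_bounds)
    also have "\<dots> = (\<integral>x\<in>A. g (snd x) \<partial>J)"
      unfolding set_lebesgue_integral_def
      by (rule Bochner_Integration.integral_cong) (auto simp: ind)
    finally show "(\<integral>x\<in>A. fst x \<partial>J) = (\<integral>x\<in>A. g (snd x) \<partial>J)" .
  qed
  moreover have "AE x in J. inv emb (snd x) \<in> {0..1}"
  proof -
    have "(\<integral>\<^sup>+x. indicator (- {0..1}) (inv emb (snd x)) \<partial>J)
        = (\<integral>\<^sup>+t. indicator (- {0..1}) (inv emb (emb t)) * indicator {0..1} t \<partial>lborel)"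
      by (rule nn_integral_LS_snd) measurable
    also have "\<dots> = (\<integral>\<^sup>+t. 0 \<partial>(lborel :: real measure))"
      by (intro nn_integral_cong) (auto simp: emb indicator_def)
    finally have "AE x in J. indicator (- {0..1}) (inv emb (snd x)) = (0 :: ennreal)"
      using nn_integral_0_iff_AE[of "\<lambda>x. indicator (- {0..1}) (inv emb (snd x))" J] by simp
    then show ?thesis by eventually_elim (auto simp: indicator_def split: if_splits)
  qed
  ultimately show ?thesis
    unfolding cond_signal_def by eventually_elim (simp add: g_def)
qed

text \<open>The posterior mean increases with the uniform \<open>t\<close>, so it is at most
  \<open>x\<close> when \<open>t\<close> is at most the root. For \<open>x > N * \<zeta>\<close> the
  root exceeds 1, hence an inequality only.\<close>

lemma emeasure_posterior_mean_le:
  assumes x: "0 \<le> x"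
  shows "emeasure J {y \<in> space J. E y \<le> x} \<le> ennreal (root (N - 1) (x / (real N * \<zeta>)))"
proof -
  define r where "r = root (N - 1) (x / (real N * \<zeta>))"
  have r: "0 \<le> r" using x \<zeta> by (simp add: r_def real_root_ge_zero)
  have N1: "0 < N - 1" using N by simp
  have "emeasure J {y \<in> space J. E y \<le> x} = (\<integral>\<^sup>+y. indicator {y \<in> space J. E y \<le> x} y \<partial>J)"
    by (rule nn_integral_indicator[symmetric], rule borel_measurable_le)
      (simp_all add: borel_measurable_integrable[OF integrable_posterior_mean])
  also have "\<dots> = (\<integral>\<^sup>+y. of_bool (real N * \<zeta> * (inv emb (snd y)) ^ (N - 1) \<le> x) \<partial>J)"
  proof (rule nn_integral_cong_AE)
    show "AE y in J. indicator {y \<in> space J. E y \<le> x} y =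
        (of_bool (real N * \<zeta> * (inv emb (snd y)) ^ (N - 1) \<le> x) :: ennreal)"
      using posterior_mean_LS AE_space by eventually_elim (simp add: indicator_def)
  qed
  also have "\<dots> = (\<integral>\<^sup>+t. of_bool (real N * \<zeta> * (inv emb (emb t)) ^ (N - 1) \<le> x) * indicator {0..1} t \<partial>lborel)"
    by (rule nn_integral_LS_snd) measurable
  also have "\<dots> \<le> (\<integral>\<^sup>+t. indicator {0..r} t \<partial>lborel)"
  proof (rule nn_integral_mono)
    fix t :: real
    have "t \<le> r" if "0 \<le> t" "real N * \<zeta> * t ^ (N - 1) \<le> x"
    proof -
      have "t ^ (N - 1) \<le> x / (real N * \<zeta>)"
        using that \<zeta> N by (simp add: pos_le_divide_eq mult_ac)
      then have "root (N - 1) (t ^ (N - 1)) \<le> r"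
        unfolding r_def by (rule real_root_le_mono[OF N1])
      then show ?thesis using that N1 by (simp add: real_root_power_cancel)
    qed
    then show "of_bool (real N * \<zeta> * (inv emb (emb t)) ^ (N - 1) \<le> x) * indicator {0..1} t
        \<le> (indicator {0..r} t :: ennreal)"
      by (auto simp: emb indicator_def)
  qed
  also have "\<dots> = ennreal r" using r by simp
  finally show ?thesis by (simp add: r_def)
qed

text \<open>The integrand is \<open>N * \<zeta> * t ^ (2 * N - 2)\<close> with \<open>t\<close>
  uniform. This is the bound on one agent's share of the welfare; \<open>N\<close> such shares give
  \<open>N * \<zeta> / (2 - 1 / N)\<close>.\<close>

lemma nn_integral_posterior_mean_square:
  "(\<integral>\<^sup>+y. ennreal (E y) * ennreal (E y / (real N * \<zeta>)) \<partial>J)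
    = ennreal (real N * \<zeta> / (2 * real N - 1))"
proof -
  have "(\<integral>\<^sup>+y. ennreal (E y) * ennreal (E y / (real N * \<zeta>)) \<partial>J)
    = (\<integral>\<^sup>+y. ennreal (real N * \<zeta>) * ennreal ((inv emb (snd y)) ^ (2 * N - 2)) \<partial>J)"
  proof (rule nn_integral_cong_AE)
    show "AE y in J. ennreal (E y) * ennreal (E y / (real N * \<zeta>))
      = ennreal (real N * \<zeta>) * ennreal ((inv emb (snd y)) ^ (2 * N - 2))"
      using posterior_mean_LS posterior_mean_bounds
    proof eventually_elim
      case (elim y)
      have "E y * (E y / (real N * \<zeta>)) = real N * \<zeta> * ((inv emb (snd y)) ^ (N - 1)) ^ 2"
        unfolding elim(1) using N \<zeta> by (simp add: power2_eq_square)
      also have "((inv emb (snd y)) ^ (N - 1)) ^ 2 = (inv emb (snd y)) ^ (2 * N - 2)"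
        using N by (simp add: power_mult[symmetric] mult.commute diff_mult_distrib2)
      finally have "E y * (E y / (real N * \<zeta>)) = real N * \<zeta> * (inv emb (snd y)) ^ (2 * N - 2)" .
      then show ?case
        using elim(2) N \<zeta> by (simp add: ennreal_mult'[symmetric])
    qed
  qed
  also have "\<dots> = (\<integral>\<^sup>+t. ennreal (real N * \<zeta>) * ennreal ((inv emb (emb t)) ^ (2 * N - 2)) * indicator {0..1} t \<partial>lborel)"
    by (rule nn_integral_LS_snd) measurable
  also have "\<dots> = ennreal (real N * \<zeta>) * (\<integral>\<^sup>+t. ennreal (t ^ (2 * N - 2)) * indicator {0..1} t \<partial>lborel)"
    by (subst nn_integral_cmult[symmetric]) (simp_all add: emb mult.assoc)
  also have "\<dots> = ennreal (real N * \<zeta> / (2 * real N - 1))"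
    using N \<zeta> by (simp add: nn_integral_power_Icc ennreal_mult'[symmetric] of_nat_diff)
  finally show ?thesis .
qed

end

section \<open>Constant utility: payoffs are selection probabilities\<close>

lemma AE_cond_signal_bernoulli:
  assumes "is_scheme Z" "u \<in> borel_measurable unit_interval" "u 0 = 1" "u 1 = 1"
  shows "AE x in joint_law (bernoulli_prior \<zeta>) Z. cond_signal (bernoulli_prior \<zeta>) Z u x = 1"
proof (rule agent.cond_signal_eq_1[OF agent_bernoulli[OF assms(1)] assms(2)])
  show "AE v in bernoulli_prior \<zeta>. u v = 1"
    using AE_bernoulli_prior by eventually_elim (use assms in auto)
qed

lemma agents_bernoulli:
  "N \<ge> 1 \<Longrightarrow> (\<And>i. i < N \<Longrightarrow> is_scheme (Z i)) \<Longrightarrow> agents N (bernoulli_prior \<zeta>) Z"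
  by (simp add: agents_def agent_bernoulli)

text \<open>Given any signal, the utility of being selected is almost surely 1, so each payoff is an
  expected selection probability, and exactly one agent is selected in every outcome.\<close>

lemma sum_payoff_bernoulli:
  assumes N: "N \<ge> 1" and Z: "\<And>i. i < N \<Longrightarrow> is_scheme (Z i)"
    and u: "\<forall>i<N. u i \<in> borel_measurable unit_interval \<and> u i 0 = 1 \<and> u i 1 = 1"
  shows "(\<Sum>i<N. payoff N (\<lambda>_. bernoulli_prior \<zeta>) u Z i) = 1"
proof -
  interpret agents N "bernoulli_prior \<zeta>" Z by (rule agents_bernoulli[OF N Z])
  interpret prob_space \<Omega> by (rule prob_space_outcome)
  let ?s = "\<lambda>i \<omega>. selection_prob N (\<lambda>j. EE j (\<omega> j)) i"
  have int: "integrable \<Omega> (?s i)" if "i < N" for i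
  proof (rule integrable_const_bound[where B=1])
    have "?s i \<omega> \<le> 1" for \<omega>
      using selection_prob_le[of N "\<lambda>j. EE j (\<omega> j)" i] by (auto simp: of_bool_def split: if_splits)
    then show "AE \<omega> in \<Omega>. norm (?s i \<omega>) \<le> 1"
      by (simp add: selection_prob_nonneg)
  qed (rule selection_prob_measurable[OF that])
  have "payoff N (\<lambda>_. bernoulli_prior \<zeta>) u Z i = (\<integral>\<omega>. ?s i \<omega> \<partial>\<Omega>)" if i: "i < N" for i
    unfolding payoff_def
  proof (rule integral_cong_AE)
    have ci: "(\<lambda>\<omega>. cond_signal (bernoulli_prior \<zeta>) (Z i) (u i) (\<omega> i)) \<in> borel_measurable \<Omega>"
      using agent.cond_signal_measurable[OF agent[OF i]] agent.sets_J[OF agent[OF i]]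
      by (intro measurable_compose[OF component_measurable[OF i]]) (simp cong: measurable_cong_sets)
    show "(\<lambda>\<omega>. ?s i \<omega> * cond_signal (bernoulli_prior \<zeta>) (Z i) (u i) (\<omega> i)) \<in> borel_measurable \<Omega>"
      by (intro borel_measurable_times selection_prob_measurable i ci)
    show "?s i \<in> borel_measurable \<Omega>" by (rule selection_prob_measurable[OF i])
    have "AE \<omega> in \<Omega>. cond_signal (bernoulli_prior \<zeta>) (Z i) (u i) (\<omega> i) = 1"
      using u i by (intro AE_component AE_cond_signal_bernoulli Z) auto
    then show "AE \<omega> in \<Omega>. ?s i \<omega> * cond_signal (bernoulli_prior \<zeta>) (Z i) (u i) (\<omega> i) = ?s i \<omega>"
      by eventually_elim simp
  qed
  then have "(\<Sum>i<N. payoff N (\<lambda>_. bernoulli_prior \<zeta>) u Z i) = (\<Sum>i<N. \<integral>\<omega>. ?s i \<omega> \<partial>\<Omega>)"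
    by simp
  also have "\<dots> = (\<integral>\<omega>. (\<Sum>i<N. ?s i \<omega>) \<partial>\<Omega>)"
    by (rule Bochner_Integration.integral_sum[symmetric]) (use int in simp)
  also have "\<dots> = 1" by (simp add: sum_selection_prob[OF N] prob_space)
  finally show ?thesis .
qed

section \<open>Equilibrium and welfare of the symmetric linear profile\<close>

context linear_signal
begin

text \<open>The winning probability at posterior mean \<open>x\<close> is at most
  \<open>x / (N * \<zeta>)\<close>, and posterior means average to \<open>\<zeta>\<close> under
  every scheme, so no choice of \<open>Z i\<close> earns more than
  \<open>\<zeta> / (N * \<zeta>)\<close>.\<close>

lemma payoff_against_linear_le:
  assumes i: "i < N" and Zi: "is_scheme (Z i)" and rivals: "\<And>j. j < N \<Longrightarrow> j \<noteq> i \<Longrightarrow> Z j = LS"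
    and u: "u i \<in> borel_measurable unit_interval" "u i 0 = 1" "u i 1 = 1"
  shows "payoff N (\<lambda>_. D) u Z i \<le> 1 / real N"
proof -
  have Z: "is_scheme (Z j)" if "j < N" for j
    using that Zi rivals is_scheme_LS by (cases "j = i") auto
  interpret A: agents N D Z by (rule agents_bernoulli[OF _ Z]) (use N in auto)
  interpret Ai: agent D "Z i" by (rule agent_bernoulli[OF Zi])
  have "AE \<omega> in A.\<Omega>. cond_signal D (Z i) (u i) (\<omega> i) = 1"
    by (rule A.AE_component[OF i AE_cond_signal_bernoulli[OF Zi u]])
  then have "(\<integral>\<^sup>+\<omega>. ennreal (selection_prob N (\<lambda>j. A.EE j (\<omega> j)) i
      * cond_signal D (Z i) (u i) (\<omega> i)) \<partial>A.\<Omega>)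
    \<le> (\<integral>\<^sup>+\<omega>. 1 * of_bool (\<forall>l<N. A.EE l (\<omega> l) \<le> A.EE i (\<omega> i)) \<partial>A.\<Omega>)"
  proof (intro nn_integral_mono_AE, eventually_elim)
    case (elim \<omega>)
    have "ennreal (selection_prob N (\<lambda>j. A.EE j (\<omega> j)) i)
        \<le> ennreal (of_bool (\<forall>l<N. A.EE l (\<omega> l) \<le> A.EE i (\<omega> i)))"
      by (rule ennreal_leI[OF selection_prob_le])
    then show ?case
      using elim by (simp only: of_bool_def mult_1 mult_1_right ennreal_0 ennreal_1 if_distrib[of ennreal])
  qed
  also have "\<dots> \<le> (\<integral>\<^sup>+y. 1 * ennreal (A.EE i y / (real N * \<zeta>)) \<partial>A.JJ i)"
  proof (rule A.nn_integral_top_le[OF i N])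
    show "0 < real N * \<zeta>" using N \<zeta> by simp
    show "emeasure (A.JJ j) {y \<in> space (A.JJ j). A.EE j y \<le> x} \<le> ennreal (root (N - 1) (x / (real N * \<zeta>)))"
      if "j < N" "j \<noteq> i" "0 \<le> x" for j x
      using emeasure_posterior_mean_le[OF that(3)] rivals[OF that(1,2)] by simp
  qed simp
  also have "\<dots> = ennreal (\<integral>y. A.EE i y / (real N * \<zeta>) \<partial>A.JJ i)"
    unfolding mult_1
  proof (rule nn_integral_eq_integral)
    show "integrable (A.JJ i) (\<lambda>y. A.EE i y / (real N * \<zeta>))"
      using Ai.integrable_posterior_mean by simp
    show "AE y in A.JJ i. 0 \<le> A.EE i y / (real N * \<zeta>)"
      using Ai.posterior_mean_bounds by eventually_elim (use N \<zeta> in simp)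
  qed
  also have "(\<integral>y. A.EE i y / (real N * \<zeta>) \<partial>A.JJ i) = 1 / real N"
    using \<zeta> \<zeta>_less_1 by (simp add: Ai.integral_posterior_mean integral_id_bernoulli_prior)
  \<comment> \<open>A bound on the nonnegative integral carries over to the Bochner integral without
    a separate proof of integrability.\<close>
  finally show ?thesis
    unfolding payoff_def by (intro integral_real_bounded) auto
qed

text \<open>The payoffs sum to 1 and none exceeds \<open>1 / N\<close>, so each equals
  \<open>1 / N\<close>. Deviations are subject to the same cap. No exact winning probability has to
  be computed.\<close>

lemma nash_equilibrium_linear:
  assumes u: "\<forall>i<N. u i \<in> borel_measurable unit_interval \<and> u i 0 = 1 \<and> u i 1 = 1"
  shows "nash_equilibrium N (\<lambda>_. D) u (\<lambda>_. LS)"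
proof -
  let ?p = "\<lambda>i. payoff N (\<lambda>_. D) u (\<lambda>_. LS) i"
  have sum: "(\<Sum>i<N. ?p i) = 1"
    by (rule sum_payoff_bernoulli) (use N u is_scheme_LS in auto)
  have le: "?p i \<le> 1 / real N" if "i < N" for i
    by (rule payoff_against_linear_le) (use that u is_scheme_LS in auto)
  have eq: "?p i = 1 / real N" if "i < N" for i
  proof -
    have "(\<Sum>i<N. 1 / real N - ?p i) = 0"
      using sum N by (simp add: sum_subtractf)
    then have "\<forall>i\<in>{..<N}. 1 / real N - ?p i = 0"
      by (subst (asm) sum_nonneg_eq_0_iff) (use le in auto)
    then show ?thesis using that by simp
  qed
  have "payoff N (\<lambda>_. D) u ((\<lambda>_. LS)(i := Z')) i \<le> ?p i" if "i < N" "is_scheme Z'" for i Z'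
    unfolding eq[OF that(1)] by (rule payoff_against_linear_le) (use that u in auto)
  then show ?thesis
    unfolding nash_equilibrium_def using is_scheme_LS by auto
qed

text \<open>The maximum is at most the sum of the posterior means of all weak maximizers; a tie is
  counted several times, which only enlarges the sum. Each summand is bounded by the second moment
  of the posterior mean over \<open>N * \<zeta>\<close>.\<close>

lemma welfare_linear_le:
  "welfare N (\<lambda>_. D) (\<lambda>_. LS) \<le> real N * \<zeta> / (2 - 1 / real N)"
proof -
  interpret A: agents N D "\<lambda>_. LS"
    by (rule agents_bernoulli[OF _ is_scheme_LS]) (use N in auto)
  let ?w = "\<lambda>i \<omega>. of_bool (\<forall>l<N. E (\<omega> l) \<le> E (\<omega> i)) :: ennreal"
  have top_meas: "(\<lambda>\<omega>. ennreal (E (\<omega> i)) * ?w i \<omega>) \<in> borel_measurable A.\<Omega>" if "i < N" for i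
  proof -
    have "Measurable.pred A.\<Omega> (\<lambda>\<omega>. \<forall>l\<in>{..<N}. E (\<omega> l) \<le> E (\<omega> i))"
    proof (rule pred_intros_finite)
      fix l assume "l \<in> {..<N}"
      then show "Measurable.pred A.\<Omega> (\<lambda>\<omega>. E (\<omega> l) \<le> E (\<omega> i))"
        by (intro pred_le_real A.EE_component_measurable that) simp
    qed simp
    then have pred: "Measurable.pred A.\<Omega> (\<lambda>\<omega>. \<forall>l<N. E (\<omega> l) \<le> E (\<omega> i))"
      unfolding Ball_def lessThan_iff .
    have "?w i \<in> borel_measurable A.\<Omega>"
      unfolding of_bool_def by (rule measurable_If[OF _ _ predE[OF pred]]) (rule measurable_const; simp)+
    moreover have "(\<lambda>\<omega>. ennreal (E (\<omega> i))) \<in> borel_measurable A.\<Omega>"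
      by (rule measurable_compose[OF A.EE_component_measurable[OF that] measurable_ennreal])
    ultimately show ?thesis by (intro borel_measurable_times_ennreal)
  qed
  have "(\<integral>\<^sup>+\<omega>. ennreal (Max ((\<lambda>j. E (\<omega> j)) ` {..<N})) \<partial>A.\<Omega>)
    \<le> (\<integral>\<^sup>+\<omega>. (\<Sum>i<N. ennreal (E (\<omega> i)) * ?w i \<omega>) \<partial>A.\<Omega>)"
  proof (rule nn_integral_mono)
    fix \<omega>
    have "Max ((\<lambda>j. E (\<omega> j)) ` {..<N}) \<in> (\<lambda>j. E (\<omega> j)) ` {..<N}"
      using N by (intro Max_in) (auto simp: lessThan_empty_iff)
    then obtain i where i: "i < N" "Max ((\<lambda>j. E (\<omega> j)) ` {..<N}) = E (\<omega> i)" by auto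
    have "E (\<omega> l) \<le> E (\<omega> i)" if "l < N" for l
      unfolding i(2)[symmetric] using that by (intro Max_ge) auto
    then have "ennreal (E (\<omega> i)) = ennreal (E (\<omega> i)) * ?w i \<omega>" by simp
    also have "\<dots> \<le> (\<Sum>i<N. ennreal (E (\<omega> i)) * ?w i \<omega>)"
      by (rule member_le_sum) (use i in auto)
    finally show "ennreal (Max ((\<lambda>j. E (\<omega> j)) ` {..<N})) \<le> (\<Sum>i<N. ennreal (E (\<omega> i)) * ?w i \<omega>)"
      unfolding i(2) .
  qed
  also have "\<dots> = (\<Sum>i<N. \<integral>\<^sup>+\<omega>. ennreal (E (\<omega> i)) * ?w i \<omega> \<partial>A.\<Omega>)"
    by (rule nn_integral_sum) (use top_meas in auto)
  also have "\<dots> \<le> (\<Sum>i<N. ennreal (real N * \<zeta> / (2 * real N - 1)))"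
  proof (rule sum_mono)
    fix i assume "i \<in> {..<N}"
    then have i: "i < N" by simp
    have "(\<integral>\<^sup>+\<omega>. ennreal (E (\<omega> i)) * ?w i \<omega> \<partial>A.\<Omega>)
      \<le> (\<integral>\<^sup>+y. ennreal (E y) * ennreal (E y / (real N * \<zeta>)) \<partial>J)"
    proof (rule A.nn_integral_top_le[OF i N])
      show "0 < real N * \<zeta>" using N \<zeta> by simp
      show "(\<lambda>y. ennreal (E y)) \<in> borel_measurable J"
        by (rule measurable_compose[OF A.EE_measurable[OF i] measurable_ennreal])
    qed (rule emeasure_posterior_mean_le)
    then show "(\<integral>\<^sup>+\<omega>. ennreal (E (\<omega> i)) * ?w i \<omega> \<partial>A.\<Omega>) \<le> ennreal (real N * \<zeta> / (2 * real N - 1))"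
      by (simp only: nn_integral_posterior_mean_square)
  qed
  also have "\<dots> = ennreal (real N * \<zeta> / (2 - 1 / real N))"
  proof -
    have "(\<Sum>i<N. ennreal (real N * \<zeta> / (2 * real N - 1))) = ennreal (\<Sum>i<N. real N * \<zeta> / (2 * real N - 1))"
      by (rule sum_ennreal) (use N \<zeta> in auto)
    also have "(\<Sum>i<N. real N * \<zeta> / (2 * real N - 1)) = real N * \<zeta> / (2 - 1 / real N)"
    proof -
      have "2 - 1 / real N = (2 * real N - 1) / real N"
        using N by (simp add: diff_divide_distrib)
      then show ?thesis by simp
    qed
    finally show ?thesis .
  qed
  finally have "(\<integral>\<^sup>+\<omega>. ennreal (Max ((\<lambda>j. E (\<omega> j)) ` {..<N})) \<partial>A.\<Omega>)
    \<le> ennreal (real N * \<zeta> / (2 - 1 / real N))" .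
  moreover have "0 \<le> real N * \<zeta> / (2 - 1 / real N)"
  proof -
    have "1 / real N \<le> 1" using N by simp
    then show ?thesis using \<zeta> by (intro divide_nonneg_nonneg) auto
  qed
  ultimately show ?thesis
    unfolding welfare_def by (intro integral_real_bounded)
qed

end

section \<open>The case of one agent and existence of an equilibrium with low welfare\<close>

lemma welfare_single:
  assumes "is_scheme (Z 0)" "0 \<le> \<zeta>" "\<zeta> \<le> 1"
  shows "welfare 1 (\<lambda>_. bernoulli_prior \<zeta>) Z = \<zeta>"
proof -
  interpret A: agents 1 "bernoulli_prior \<zeta>" Z
    by (rule agents_bernoulli) (use assms in auto)
  have "welfare 1 (\<lambda>_. bernoulli_prior \<zeta>) Z = (\<integral>\<omega>. A.EE 0 (\<omega> 0) \<partial>A.\<Omega>)"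
    unfolding welfare_def by (simp add: lessThan_Suc)
  also have "\<dots> = \<zeta>"
    using A.integral_component[OF _ A.EE_measurable, of 0]
      agent.integral_posterior_mean[OF A.agent, of 0] assms
    by (simp add: integral_id_bernoulli_prior)
  finally show ?thesis .
qed

text \<open>A sole agent is always selected, so her payoff is 1 under every scheme.\<close>

lemma nash_equilibrium_single:
  assumes "is_scheme (Z 0)"
    and u: "u 0 \<in> borel_measurable unit_interval" "u 0 0 = 1" "u 0 1 = 1"
  shows "nash_equilibrium 1 (\<lambda>_. bernoulli_prior \<zeta>) u Z"
proof -
  have "payoff 1 (\<lambda>_. bernoulli_prior \<zeta>) u Z' 0 = 1" if "is_scheme (Z' 0)" for Z'
    using sum_payoff_bernoulli[of 1 Z' u \<zeta>] that u by simp
  from this[of Z] this[of "Z(0 := Z')" for Z'] show ?thesis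
    using assms(1) by (simp add: nash_equilibrium_def)
qed

text \<open>An uninformative scheme, the witness for one agent.\<close>

lemma is_scheme_const: "is_scheme (count_space UNIV, \<lambda>_. return (count_space UNIV) s)"
  unfolding is_scheme_def
  by (auto intro!: measurable_const simp: space_prob_algebra prob_space_return)

text \<open>For \<open>N = 1\<close> the welfare bound reads \<open>\<zeta>\<close>, which every
  profile attains; for larger \<open>N\<close> the symmetric linear profile is the witness.\<close>

lemma exists_equilibrium_low_welfare:
  fixes emb :: "real \<Rightarrow> 's"
  assumes "N \<ge> 1" "0 < \<zeta>" "real N * \<zeta> \<le> 1" "inj emb"
    and u: "\<forall>i<N. u i \<in> borel_measurable unit_interval \<and> u i 0 = 1 \<and> u i 1 = 1"
  obtains Z :: "nat \<Rightarrow> 's scheme"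
  where "nash_equilibrium N (\<lambda>_. bernoulli_prior \<zeta>) u Z"
    and "welfare N (\<lambda>_. bernoulli_prior \<zeta>) Z \<le> real N * \<zeta> / (2 - 1 / real N)"
proof (cases "N = 1")
  case True
  let ?Z = "\<lambda>_::nat. (count_space UNIV, \<lambda>_. return (count_space UNIV) (emb 0)) :: 's scheme"
  show thesis
  proof (rule that)
    show "nash_equilibrium N (\<lambda>_. bernoulli_prior \<zeta>) u ?Z"
      unfolding True by (rule nash_equilibrium_single) (use u True is_scheme_const in auto)
    show "welfare N (\<lambda>_. bernoulli_prior \<zeta>) ?Z \<le> real N * \<zeta> / (2 - 1 / real N)"
      unfolding True using assms True by (subst welfare_single) (auto simp: is_scheme_const)
  qed
next
  case False
  then interpret linear_signal emb N \<zeta>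
    using assms by unfold_locales auto
  show thesis
    by (rule that[OF nash_equilibrium_linear[OF u] welfare_linear_le])
qed

section \<open>Bounding the price of anarchy\<close>

theorem theorem3p1:
  fixes N :: nat and \<zeta> :: real and u :: "nat \<Rightarrow> real \<Rightarrow> real" and embed :: "real \<Rightarrow> 's"
  assumes "N \<ge> 1" and "0 < \<zeta>" and "real N * \<zeta> \<le> 1"
    and "\<forall>i<N. u i \<in> borel_measurable unit_interval \<and> u i 0 = 1 \<and> u i 1 = 1"
    and "inj embed"
  shows "(\<exists>Z :: nat \<Rightarrow> 's scheme. nash_equilibrium N (\<lambda>_. bernoulli_prior \<zeta>) u Z)
    \<and> price_of_anarchy TYPE('s) N (\<lambda>_. bernoulli_prior \<zeta>) u \<ge> poa_bound N \<zeta>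
    \<and> poa_bound N \<zeta> \<in> {1.264 - 1 / real N .. 2 - 1 / real N}
    \<and> (\<forall>\<^sub>F n in sequentially. \<forall>z>0. real n * z \<le> 1 \<longrightarrow>
         poa_bound n z \<in> {1.264 .. 2 - 1 / real n})"
proof (intro conjI)
  obtain Z :: "nat \<Rightarrow> 's scheme" where Z: "nash_equilibrium N (\<lambda>_. bernoulli_prior \<zeta>) u Z"
    "welfare N (\<lambda>_. bernoulli_prior \<zeta>) Z \<le> real N * \<zeta> / (2 - 1 / real N)"
    using exists_equilibrium_low_welfare[OF assms(1-3,5,4)] by blast
  show "\<exists>Z :: nat \<Rightarrow> 's scheme. nash_equilibrium N (\<lambda>_. bernoulli_prior \<zeta>) u Z"
    using Z(1) by blast
  have "1 * \<zeta> \<le> real N * \<zeta>" using assms by (intro mult_right_mono) auto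
  then have \<zeta>1: "\<zeta> \<le> 1" using assms(3) by linarith
  define W where "W = {welfare N (\<lambda>_. bernoulli_prior \<zeta>) Z | Z :: nat \<Rightarrow> 's scheme.
    nash_equilibrium N (\<lambda>_. bernoulli_prior \<zeta>) u Z}"
  have ge: "\<zeta> \<le> w" if "w \<in> W" for w
  proof -
    from that obtain Z' :: "nat \<Rightarrow> 's scheme" where w: "w = welfare N (\<lambda>_. bernoulli_prior \<zeta>) Z'"
      and Z': "nash_equilibrium N (\<lambda>_. bernoulli_prior \<zeta>) u Z'"
      by (auto simp: W_def)
    interpret agents N "bernoulli_prior \<zeta>" Z'
      by (rule agents_bernoulli) (use assms Z' in \<open>auto simp: nash_equilibrium_def\<close>)
    show ?thesis
      using welfare_ge assms \<zeta>1 by (simp add: w integral_id_bernoulli_prior)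
  qed
  have mem: "welfare N (\<lambda>_. bernoulli_prior \<zeta>) Z \<in> W"
    using Z(1) by (auto simp: W_def)
  \<comment> \<open>Positivity is essential: were the infimum 0, the quotient would be 0 by the
    convention for division.\<close>
  have Inf_pos: "0 < Inf W"
    using cInf_greatest[of W \<zeta>] mem ge assms(2) by (metis empty_iff less_le_trans)
  \<comment> \<open>An infimum of reals lies below the members only if the set is bounded below;
    \<open>\<zeta>\<close> serves as the bound.\<close>
  have Inf_le: "Inf W \<le> real N * \<zeta> / (2 - 1 / real N)"
    using cInf_lower[OF mem, OF bdd_belowI[of W \<zeta>, OF ge]] Z(2) by simp
  have N1: "1 / real N \<le> 1" using assms by simp
  have "poa_bound N \<zeta> = (1 - exp (- (real N * \<zeta>))) / (real N * \<zeta> / (2 - 1 / real N))"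
    by (simp add: poa_bound_def)
  also have "\<dots> \<le> first_best N (\<lambda>_. bernoulli_prior \<zeta>) / Inf W"
  proof (rule frac_le)
    show "1 - exp (- (real N * \<zeta>)) \<le> first_best N (\<lambda>_. bernoulli_prior \<zeta>)"
      using assms \<zeta>1 by (intro first_best_bernoulli_ge) auto
    moreover have "0 \<le> 1 - exp (- (real N * \<zeta>))" using assms by simp
    ultimately show "0 \<le> first_best N (\<lambda>_. bernoulli_prior \<zeta>)" by linarith
  qed (use Inf_pos Inf_le in auto)
  finally show "price_of_anarchy TYPE('s) N (\<lambda>_. bernoulli_prior \<zeta>) u \<ge> poa_bound N \<zeta>"
    by (simp add: price_of_anarchy_def W_def)
  show "poa_bound N \<zeta> \<in> {1.264 - 1 / real N .. 2 - 1 / real N}"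
  proof -
    have "0 \<le> 1 / real N" by simp
    \<comment> \<open>Here 2 * 0.63212 exceeds 1.264 and 0.63212 is below 1, so subtracting the full
      \<open>1 / N\<close> makes the lower end valid for every \<open>N\<close>.\<close>
    then have "1.264 - 1 / real N \<le> (2 - 1 / real N) * 0.63212"
      by (simp add: algebra_simps)
    then show ?thesis
      using poa_bound_le[of N \<zeta>] poa_bound_ge[of N \<zeta>] assms by simp
  qed
qed (rule eventually_poa_bound_in)

end
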